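(* Let $m,n$ be positive integers with $mn\geqslant2$. Then $F_m\otimes F_n$ is ideal, extremal, and $\dim\mathcal{C}(F_m\otimes F_n)=mn$.
   Context: $F_n$ is the $n\times n$ matrix with $(i,j)$-entry $\omega_n^{(i-1)(j-1)}$, where $\omega_n=\cos(2\pi/n)-\mathsf{i}\sin(2\pi/n)$. $A\otimes B=[a_{ij}B]$ is the Kronecker product. A matrix $A\geqslant 0$ (nonnegative) has real nonnegative entries. For $N\geqslant 2$, an $N\times N$ matrix is reducible if it is permutation-similar to a block upper triangular matrix with two nonempty square diagonal blocks, and irreducible otherwise. An invertible complex $N\times N$ matrix $S$ is a Perron similarity if $SDS^{-1}$ is irreducible and nonnegative for some diagonal matrix $D$. For $x\in\mathbb{C}^N$, $D_x$ is the diagonal matrix with diagonal $x$, $M_x:=SD_xS^{-1}$, and $e$ is the all-ones vector. Put $\mathcal{C}(S):=\{x\in\mathbb{C}^N\mid M_x\geqslant0\}$ and $\mathcal{P}(S):=\{x\in\mathcal{C}(S)\mid M_xe=e\}$. The row cone $\mathcal{C}_r(S)$ is the set of all linear combinations with nonnegative real coefficients of the rows of $S$ (viewed as column vectors). A Perron similarity $S$ is ideal if $\mathcal{C}(S)=\mathcal{C}_r(S)$. The dimension of a convex cone $K$ is the dimension of the real vector space $K+(-K)$. A stochastic matrix is a nonnegative matrix all of whose row sums equal $1$. Let $\mathbb{SL}_1^N$ be the set of $x\in\mathbb{C}^N$ with $x_1=1$ such that the multiset $\{x_1,\dots,x_N\}$ is the spectrum of some $N\times N$ stochastic matrix, and let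 $\pi_1:\mathbb{C}^N\to\mathbb{C}^{N-1}$ delete the first coordinate. A point $x\in\mathbb{SL}_1^N$ is extremal if $\alpha\,\pi_1(x)\notin\pi_1(\mathbb{SL}_1^N)$ for all $\alpha>1$. A Perron similarity $S$ whose first column is $e$ is extremal if $\mathcal{P}(S)$ contains an extremal point of $\mathbb{SL}_1^N$ other than $e$. *)

theory Defs
  imports
    "HOL-Library.Nonpos_Ints"
    "HOL-Combinatorics.Permutations"
    "Jordan_Normal_Form.Char_Poly"
    "Jordan_Normal_Form.VS_Connect"
    "Jordan_Normal_Form.Gauss_Jordan_Elimination"
begin

text \<open>
  The space of all complex $N$-vectors is \<open>carrier_vec N :: complex vec set\<close>. Indices start at \<open>0\<close>,
  so the first coordinate, row or column has index \<open>0\<close>.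
\<close>

definition omega :: "nat \<Rightarrow> complex" where
  "omega n = complex_of_real (cos (2 * pi / real n)) - \<i> * complex_of_real (sin (2 * pi / real n))"

definition fourier_mat :: "nat \<Rightarrow> complex mat" where
  "fourier_mat n = mat n n (\<lambda>(i, j). omega n ^ (i * j))"

definition kronecker :: "'a :: times mat \<Rightarrow> 'a mat \<Rightarrow> 'a mat" (infixl \<open>\<otimes>\<^sub>K\<close> 70) where
  "A \<otimes>\<^sub>K B = mat (dim_row A * dim_row B) (dim_col A * dim_col B)
     (\<lambda>(i, j). A $$ (i div dim_row B, j div dim_col B) * B $$ (i mod dim_row B, j mod dim_col B))"

definition nonneg_mat :: "complex mat \<Rightarrow> bool" where
  "nonneg_mat A \<longleftrightarrow> elements_mat A \<subseteq> \<real>\<^sub>\<ge>\<^sub>0"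

definition perm_mat :: "nat \<Rightarrow> (nat \<Rightarrow> nat) \<Rightarrow> complex mat" where
  "perm_mat N p = mat N N (\<lambda>(i, j). if i = p j then 1 else 0)"

definition reducible_mat :: "complex mat \<Rightarrow> bool" where
  "reducible_mat A \<longleftrightarrow>
     (\<exists>N p r B C D. A \<in> carrier_mat N N \<and> p permutes {..<N} \<and> 0 < r \<and> r < N \<and>
        B \<in> carrier_mat r r \<and> C \<in> carrier_mat r (N - r) \<and> D \<in> carrier_mat (N - r) (N - r) \<and>
        perm_mat N p * A * transpose_mat (perm_mat N p) = four_block_mat B C (0\<^sub>m (N - r) r) D)"

text \<open>Reducibility and irreducibility are only defined for order at least \<open>2\<close>.\<close>

definition irreducible_mat :: "complex mat \<Rightarrow> bool" where
  "irreducible_mat A \<longleftrightarrow> square_mat A \<and> 2 \<le> dim_row A \<and> \<not> reducible_mat A"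

text \<open>\<open>mat_inverse\<close> returns an option, which is \<open>Some\<close> exactly for invertible matrices.\<close>

abbreviation mat_inv :: "complex mat \<Rightarrow> complex mat" where
  "mat_inv S \<equiv> the (mat_inverse S)"

definition perron_similarity :: "complex mat \<Rightarrow> bool" where
  "perron_similarity S \<longleftrightarrow> invertible_mat S \<and>
     (\<exists>D \<in> carrier_mat (dim_row S) (dim_row S). diagonal_mat D \<and>
        irreducible_mat (S * D * mat_inv S) \<and> nonneg_mat (S * D * mat_inv S))"

definition ones_vec :: "nat \<Rightarrow> complex vec" where
  "ones_vec N = vec N (\<lambda>_. 1)"

definition M_mat :: "complex mat \<Rightarrow> complex vec \<Rightarrow> complex mat" where
  "M_mat S x = S * mat_diag (dim_vec x) (\<lambda>i. x $ i) * mat_inv S"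

definition spectracone :: "complex mat \<Rightarrow> complex vec set" where
  "spectracone S = {x \<in> carrier_vec (dim_row S). nonneg_mat (M_mat S x)}"

definition spectratope :: "complex mat \<Rightarrow> complex vec set" where
  "spectratope S = {x \<in> spectracone S. M_mat S x *\<^sub>v ones_vec (dim_row S) = ones_vec (dim_row S)}"

definition row_cone :: "complex mat \<Rightarrow> complex vec set" where
  "row_cone S = {x. \<exists>c :: nat \<Rightarrow> real. (\<forall>i < dim_row S. 0 \<le> c i) \<and>
     x = finsum_vec TYPE(complex) (dim_col S)
           (\<lambda>i. complex_of_real (c i) \<cdot>\<^sub>v row S i) {..<dim_row S}}"

definition ideal_similarity :: "complex mat \<Rightarrow> bool" where
  "ideal_similarity S \<longleftrightarrow> perron_similarity S \<and> spectracone S = row_cone S"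

definition stochastic_mat :: "complex mat \<Rightarrow> bool" where
  "stochastic_mat A \<longleftrightarrow> nonneg_mat A \<and> (\<forall>i < dim_row A. (\<Sum>j < dim_col A. A $$ (i, j)) = 1)"

text \<open>The spectrum as a multiset is the multiset of roots of the characteristic polynomial.\<close>

definition SL1 :: "nat \<Rightarrow> complex vec set" where
  "SL1 N = {x \<in> carrier_vec N. x $ 0 = 1 \<and>
     (\<exists>A \<in> carrier_mat N N. stochastic_mat A \<and> mset (list_of_vec x) = proots (char_poly A))}"

definition pi1 :: "complex vec \<Rightarrow> complex vec" where
  "pi1 x = vec (dim_vec x - 1) (\<lambda>i. x $ Suc i)"

definition extremal_point :: "nat \<Rightarrow> complex vec \<Rightarrow> bool" where
  "extremal_point N x \<longleftrightarrow> x \<in> SL1 N \<and>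
     (\<forall>\<alpha> :: real. 1 < \<alpha> \<longrightarrow> complex_of_real \<alpha> \<cdot>\<^sub>v pi1 x \<notin> pi1 ` SL1 N)"

definition extremal_similarity :: "complex mat \<Rightarrow> bool" where
  "extremal_similarity S \<longleftrightarrow> perron_similarity S \<and> col S 0 = ones_vec (dim_row S) \<and>
     (\<exists>x \<in> spectratope S. extremal_point (dim_row S) x \<and> x \<noteq> ones_vec (dim_row S))"

text \<open>
  A set \<open>W\<close> of complex \<open>N\<close>-vectors as a vector space over the reals (\<open>module_vec\<close> would give the
  complex scalars). The fields \<open>mult\<close> and \<open>one\<close> of the record play no role in a module.
\<close>

definition real_vs :: "nat \<Rightarrow> complex vec set \<Rightarrow> (real, complex vec) module" where
  "real_vs N W = \<lparr>carrier = W, mult = undefined, one = undefined, zero = 0\<^sub>v N, add = (+),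
     smult = (\<lambda>r v. complex_of_real r \<cdot>\<^sub>v v)\<rparr>"

definition cone_dim :: "nat \<Rightarrow> complex vec set \<Rightarrow> nat" where
  "cone_dim N K = vectorspace.dim class_ring (real_vs N {u - v | u v. u \<in> K \<and> v \<in> K})"

end

theory Submission
  imports Defs
begin

text \<open>
  The rows of $F_n$ are the characters of $\mathbb{Z}/n$, and the rows of $F_m \otimes F_n$ are the
  characters of $\mathbb{Z}/m \times \mathbb{Z}/n$. Three features of such a table $S$ of order $N$
  suffice for everything: the rows are orthogonal, so that $S^{-1} = S^*/N$; the entrywise product
  of two rows is again a row; and the first row and the first column consist of ones. They are
  isolated in the locale \<open>character_table\<close>, which contains the Fourier matrices and is closed
  under Kronecker products.

  Let $x$ be row $i$ of such a table. Then row $a$ of $S D_x$ is the entrywise product of the rows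
  $i$ and $a$, that is, another row of $S$, so row $a$ of $M_x = S D_x S^{-1}$ is a unit vector.
  Hence nonnegative combinations of the rows lie in the spectracone. Conversely, the first row of
  $S$ is $e^T$, so the first row $c^T$ of $M_x$ satisfies $c^T S = e^T D_x = x^T$: the vector $x$ is
  the combination of the rows whose coefficients are the entries of $c$, and these are nonnegative if
  $M_x$ is. So the two cones agree. They span a real space of dimension $N$, because the rows are
  linearly independent.

  The point $x = N e_1$ makes $M_x$ the matrix of ones, which is irreducible, so $S$ is a Perron
  similarity. Finally, let $x$ be a row other than the first. Its entries have modulus $1$, and
  $M_x$ is stochastic with spectrum $x$. No eigenvalue of a stochastic matrix lies outside the unit
  disc, so $x$ cannot be scaled outwards, and $x$ is extremal.
\<close>

section \<open>Nonnegative, stochastic and irreducible matrices\<close>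

lemma sum_nonneg_Reals:
  assumes "\<And>i. i \<in> A \<Longrightarrow> f i \<in> \<real>\<^sub>\<ge>\<^sub>0"
  shows "sum f A \<in> \<real>\<^sub>\<ge>\<^sub>0"
  using assms by (induction A rule: infinite_finite_induct) (auto intro: nonneg_Reals_add_I)

lemma nonneg_mat_iff:
  assumes "A \<in> carrier_mat nr nc"
  shows "nonneg_mat A \<longleftrightarrow> (\<forall>i<nr. \<forall>j<nc. A $$ (i, j) \<in> \<real>\<^sub>\<ge>\<^sub>0)"
  using assms unfolding nonneg_mat_def by fastforce

text \<open>
  A permutation similarity leaves the matrix of ones unchanged, so it never produces the zero block
  that reducibility asks for.
\<close>

lemma irreducible_mat_of_ones:
  assumes "2 \<le> N"
  shows "irreducible_mat (mat N N (\<lambda>_. 1))"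
proof -
  let ?J = "mat N N (\<lambda>_. 1) :: complex mat"
  have False if "reducible_mat ?J"
  proof -
    from that obtain p r B C D where p: "p permutes {..<N}" and r: "0 < r" "r < N"
      and blocks: "B \<in> carrier_mat r r" "C \<in> carrier_mat r (N - r)" "D \<in> carrier_mat (N - r) (N - r)"
      and eq: "perm_mat N p * ?J * transpose_mat (perm_mat N p)
        = four_block_mat B C (0\<^sub>m (N - r) r) D"
      unfolding reducible_mat_def by auto
    have row_sum: "(\<Sum>k<N. perm_mat N p $$ (i, k)) = 1" if "i < N" for i
    proof -
      have "(\<Sum>k<N. perm_mat N p $$ (i, k)) = (\<Sum>k<N. if i = p k then 1 else 0)"
        using that by (simp add: perm_mat_def)
      also have "\<dots> = (\<Sum>k<N. if i = k then 1 else 0)"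
        using sum.permute[OF p, of "\<lambda>k. if i = k then 1 else 0 :: complex"] by (simp add: o_def)
      finally show ?thesis using that by simp
    qed
    have "perm_mat N p * ?J = ?J"
      using row_sum by (intro eq_matI) (auto simp: perm_mat_def scalar_prod_def lessThan_atLeast0)
    moreover have "?J * transpose_mat (perm_mat N p) = ?J"
      using row_sum by (intro eq_matI) (auto simp: perm_mat_def scalar_prod_def lessThan_atLeast0)
    ultimately have "?J $$ (r, 0) = four_block_mat B C (0\<^sub>m (N - r) r) D $$ (r, 0)"
      using eq by simp
    then show False using blocks r by simp
  qed
  then show ?thesis using assms unfolding irreducible_mat_def by auto
qed

text \<open>
  An eigenvalue equation, read off at a coordinate where the eigenvector has the largest modulus,
  exhibits $\lambda v_i$ as a weighted mean of numbers of modulus at most $|v_i|$.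
\<close>

lemma stochastic_mat_eigenvalue_norm_le:
  assumes A: "A \<in> carrier_mat N N" and st: "stochastic_mat A"
    and ev: "eigenvalue A l"
  shows "cmod l \<le> 1"
proof -
  from ev obtain v where v: "v \<in> carrier_vec N" "v \<noteq> 0\<^sub>v N" "A *\<^sub>v v = l \<cdot>\<^sub>v v"
    using A unfolding eigenvalue_def eigenvector_def by auto
  from v(1,2) obtain k where k: "k < N" "v $ k \<noteq> 0"
    by (metis carrier_vecD eq_vecI index_zero_vec(1,2))
  define m where "m = Max ((\<lambda>i. cmod (v $ i)) ` {..<N})"
  have le_m: "cmod (v $ i) \<le> m" if "i < N" for i
    unfolding m_def using that by (intro Max_ge) auto
  have "m \<in> (\<lambda>i. cmod (v $ i)) ` {..<N}"
    unfolding m_def using k by (intro Max_in) auto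
  then obtain i where i: "i < N" "cmod (v $ i) = m" by auto
  have m_pos: "0 < m" using le_m[OF k(1)] k(2) by (meson less_le_trans zero_less_norm_iff)
  have abs: "complex_of_real (cmod (A $$ (i, j))) = A $$ (i, j)" if "j < N" for j
  proof -
    have "A $$ (i, j) \<in> \<real>\<^sub>\<ge>\<^sub>0"
      using st i that by (simp add: stochastic_mat_def nonneg_mat_iff[OF A])
    then show ?thesis by (auto elim!: nonneg_Reals_cases)
  qed
  have "complex_of_real (\<Sum>j<N. cmod (A $$ (i, j))) = (\<Sum>j<N. A $$ (i, j))"
    using abs by simp
  also have "\<dots> = 1" using st A i by (auto simp: stochastic_mat_def)
  finally have sum1: "(\<Sum>j<N. cmod (A $$ (i, j))) = 1"
    using of_real_eq_1_iff by blast
  have "l * v $ i = (A *\<^sub>v v) $ i" using v i by simp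
  also have "\<dots> = (\<Sum>j<N. A $$ (i, j) * v $ j)"
    using A v(1) i by (simp add: scalar_prod_def lessThan_atLeast0)
  finally have "cmod l * m = cmod (\<Sum>j<N. A $$ (i, j) * v $ j)"
    using i by (metis norm_mult)
  also have "\<dots> \<le> (\<Sum>j<N. cmod (A $$ (i, j)) * m)"
    by (rule sum_norm_le) (auto simp: norm_mult intro!: mult_left_mono le_m)
  also have "\<dots> = m" by (simp add: sum1 flip: sum_distrib_right)
  finally show ?thesis using m_pos by simp
qed

lemma SL1_norm_le:
  assumes "x \<in> SL1 N" "i < N"
  shows "cmod (x $ i) \<le> 1"
proof -
  from assms obtain A where x: "x \<in> carrier_vec N" and A: "A \<in> carrier_mat N N" "stochastic_mat A"
    and spec: "mset (list_of_vec x) = proots (char_poly A)"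
    unfolding SL1_def by auto
  have nz: "char_poly A \<noteq> 0" using degree_monic_char_poly[OF A(1)] by auto
  have "x $ i \<in> set (list_of_vec x)"
    using x assms(2) by (metis carrier_vecD length_list_of_vec list_of_vec_index nth_mem)
  then have "x $ i \<in># proots (char_poly A)" by (simp flip: spec)
  then have "poly (char_poly A) (x $ i) = 0" using nz by simp
  then show ?thesis
    using stochastic_mat_eigenvalue_norm_le[OF A] eigenvalue_root_char_poly[OF A(1)] by blast
qed

lemma extremal_point_if_unimodular_entry:
  assumes x: "x \<in> SL1 N" and k: "0 < k" "k < N" "cmod (x $ k) = 1"
  shows "extremal_point N x"
  unfolding extremal_point_def
proof (intro conjI allI impI notI)
  fix \<alpha> :: real
  assume \<alpha>: "1 < \<alpha>" and "complex_of_real \<alpha> \<cdot>\<^sub>v pi1 x \<in> pi1 ` SL1 N"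
  then obtain y where y: "y \<in> SL1 N" "pi1 y = complex_of_real \<alpha> \<cdot>\<^sub>v pi1 x" by auto
  have dims: "dim_vec x = N" "dim_vec y = N" using x y by (auto simp: SL1_def)
  obtain i where i: "k = Suc i" using k(1) by (cases k) auto
  have "y $ k = pi1 y $ i" using dims k i by (simp add: pi1_def)
  also have "\<dots> = complex_of_real \<alpha> * x $ k" unfolding y(2) using dims k i by (simp add: pi1_def)
  finally have "cmod (y $ k) = \<alpha>" using \<alpha> k by (simp add: norm_mult)
  then show False using SL1_norm_le[OF y(1) k(2)] \<alpha> by simp
qed (rule x)

section \<open>Dimension of real subspaces of complex coordinate space\<close>

lemma module_real_vs:
  assumes W: "W \<subseteq> carrier_vec N" and zero: "0\<^sub>v N \<in> W"
    and add: "\<And>u v. u \<in> W \<Longrightarrow> v \<in> W \<Longrightarrow> u + v \<in> W"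
    and smult: "\<And>r u. u \<in> W \<Longrightarrow> complex_of_real r \<cdot>\<^sub>v u \<in> W"
  shows "module (class_ring :: real ring) (real_vs N W)"
proof (rule module_criteria)
  have "field (class_ring :: real ring)" by (rule class_field)
  then show "cring (class_ring :: real ring)"
    by (simp add: field_def domain_def)
  show "\<forall>v\<in>carrier (real_vs N W). \<exists>neg_v\<in>carrier (real_vs N W).
          v \<oplus>\<^bsub>real_vs N W\<^esub> neg_v = \<zero>\<^bsub>real_vs N W\<^esub>"
  proof
    fix v assume v: "v \<in> carrier (real_vs N W)"
    have "complex_of_real (-1) \<cdot>\<^sub>v v \<in> W" using v by (intro smult) (simp add: real_vs_def)
    moreover have "v + complex_of_real (-1) \<cdot>\<^sub>v v = 0\<^sub>v N"
      using v W by (intro eq_vecI) (auto simp: real_vs_def)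
    ultimately show "\<exists>neg_v\<in>carrier (real_vs N W).
        v \<oplus>\<^bsub>real_vs N W\<^esub> neg_v = \<zero>\<^bsub>real_vs N W\<^esub>"
      by (auto simp: real_vs_def)
  qed
qed (use assms in \<open>auto simp: real_vs_def smult_smult_assoc add_smult_distrib_vec
      intro!: smult_add_distrib_vec[of _ N] comm_add_vec[of _ N] assoc_add_vec[of _ N]
      right_zero_vec[of _ N]\<close>)

text \<open>
  Linear combinations in \<open>real_vs\<close> are computed coordinatewise, so that \<open>gen\<close> and \<open>indep\<close>, which only
  involve sums of complex numbers, amount to the vectors \<open>b i\<close> forming a basis.
\<close>

lemma dim_real_vs:
  assumes W: "W \<subseteq> carrier_vec N" and zero: "0\<^sub>v N \<in> W"
    and add: "\<And>u v. u \<in> W \<Longrightarrow> v \<in> W \<Longrightarrow> u + v \<in> W"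
    and smult: "\<And>r u. u \<in> W \<Longrightarrow> complex_of_real r \<cdot>\<^sub>v u \<in> W"
    and b: "\<And>i. i < k \<Longrightarrow> b i \<in> W" "inj_on b {..<k}"
    and gen: "\<And>w. w \<in> W \<Longrightarrow> \<exists>c. \<forall>j<N. w $ j = (\<Sum>i<k. complex_of_real (c i) * b i $ j)"
    and indep: "\<And>c. (\<forall>j<N. (\<Sum>i<k. complex_of_real (c i) * b i $ j) = 0) \<Longrightarrow> \<forall>i<k. c i = 0"
  shows "vectorspace.dim (class_ring :: real ring) (real_vs N W) = k"
proof -
  let ?V = "real_vs N W"
  interpret V: vectorspace "class_ring :: real ring" ?V
    unfolding vectorspace_def using module_real_vs[OF W zero add smult] class_field by auto
  have finsum_index: "(\<Oplus>\<^bsub>?V\<^esub>v\<in>F. f v) \<in> W \<and> (\<Oplus>\<^bsub>?V\<^esub>v\<in>F. f v) $ j = (\<Sum>v\<in>F. f v $ j)"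
    if "finite F" "f \<in> F \<rightarrow> W" "j < N" for F f j
    using that
  proof (induction F rule: finite_induct)
    case empty
    then show ?case using zero V.M.finsum_empty[of f] by (auto simp: real_vs_def)
  next
    case (insert v F)
    have "f v \<in> W" "f \<in> F \<rightarrow> W" using insert.prems by auto
    moreover from this have "(\<Oplus>\<^bsub>?V\<^esub>u\<in>insert v F. f u) = f v + (\<Oplus>\<^bsub>?V\<^esub>u\<in>F. f u)"
      using V.M.finsum_insert[OF insert.hyps(1,2), of f] by (simp add: real_vs_def)
    ultimately show ?case using insert W add by (auto simp: subset_iff)
  qed
  let ?B = "b ` {..<k}"
  have BW: "?B \<subseteq> W" using b by auto
  have lincomb_index: "V.lincomb a ?B \<in> W \<and>
      V.lincomb a ?B $ j = (\<Sum>i<k. complex_of_real (a (b i)) * b i $ j)" if "j < N" for a j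
  proof -
    have "V.lincomb a ?B \<in> W \<and> V.lincomb a ?B $ j
        = (\<Sum>v\<in>?B. (complex_of_real (a v) \<cdot>\<^sub>v v) $ j)"
      using finsum_index[of ?B "\<lambda>v. complex_of_real (a v) \<cdot>\<^sub>v v" j] BW smult that
      unfolding V.lincomb_def by (auto simp: real_vs_def)
    moreover have "(\<Sum>v\<in>?B. (complex_of_real (a v) \<cdot>\<^sub>v v) $ j)
        = (\<Sum>i<k. complex_of_real (a (b i)) * b i $ j)"
    proof -
      have "(complex_of_real (a (b i)) \<cdot>\<^sub>v b i) $ j = complex_of_real (a (b i)) * b i $ j"
        if "i < k" for i
        using b(1)[OF that] W \<open>j < N\<close> by auto
      then show ?thesis by (simp add: sum.reindex[OF b(2)])
    qed
    ultimately show ?thesis by simp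
  qed
  have "V.basis ?B"
    unfolding V.basis_def
  proof (intro conjI)
    show "V.lin_indpt ?B"
    proof (rule V.finite_lin_indpt2)
      fix a assume "V.lincomb a ?B = \<zero>\<^bsub>?V\<^esub>"
      then have "V.lincomb a ?B = 0\<^sub>v N" by (simp add: real_vs_def)
      then have "\<forall>j<N. (\<Sum>i<k. complex_of_real (a (b i)) * b i $ j) = 0"
        using lincomb_index[of _ a] by (metis index_zero_vec(1))
      from indep[OF this] show "\<forall>v\<in>?B. a v = \<zero>\<^bsub>class_ring\<^esub>" by simp
    qed (use BW in \<open>auto simp: real_vs_def\<close>)
    have "w \<in> V.span ?B" if w: "w \<in> W" for w
    proof -
      obtain c where c: "\<forall>j<N. w $ j = (\<Sum>i<k. complex_of_real (c i) * b i $ j)"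
        using gen[OF w] by auto
      define a where "a v = c (the_inv_into {..<k} b v)" for v
      have a: "a (b i) = c i" if "i < k" for i
        using that by (simp add: a_def the_inv_into_f_f[OF b(2)])
      have closed: "V.lincomb a ?B \<in> W"
        using V.lincomb_closed[of ?B a] BW by (simp add: real_vs_def)
      have "w = V.lincomb a ?B"
      proof (rule eq_vecI)
        fix j assume "j < dim_vec (V.lincomb a ?B)"
        then have "j < N" using closed W by (auto simp: subset_iff)
        then show "w $ j = V.lincomb a ?B $ j" using c a lincomb_index[of j a] by simp
      next
        have "w \<in> carrier_vec N" "V.lincomb a ?B \<in> carrier_vec N" using w closed W by auto
        then show "dim_vec w = dim_vec (V.lincomb a ?B)" by simp
      qed
      then show ?thesis unfolding V.span_def by (auto intro!: exI[of _ a] exI[of _ ?B])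
    qed
    moreover have "V.span ?B \<subseteq> carrier ?V"
      using BW by (intro V.span_is_subset2) (simp add: real_vs_def)
    ultimately show "V.span ?B = carrier ?V" by (auto simp: real_vs_def)
  qed (use BW in \<open>simp add: real_vs_def\<close>)
  then have "V.dim = card ?B" by (intro V.dim_basis) auto
  then show ?thesis by (simp add: card_image[OF b(2)])
qed

section \<open>Character tables of finite abelian groups\<close>

text \<open>
  Row \<open>i\<close> lists the values of a character of an abelian group of order \<open>N\<close>, with the trivial
  character in row \<open>0\<close> and the neutral element in column \<open>0\<close>. Instead of an indexing of the rows by
  a group, \<open>mult_row\<close> only records that products of characters are characters; this keeps the
  Kronecker product free of bookkeeping.
\<close>

locale character_table =
  fixes N :: nat and S :: "complex mat"
  assumes carrier: "S \<in> carrier_mat N N"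
    and order_pos: "0 < N"
    and first_row: "j < N \<Longrightarrow> S $$ (0, j) = 1"
    and first_col: "i < N \<Longrightarrow> S $$ (i, 0) = 1"
    and unimodular: "i < N \<Longrightarrow> j < N \<Longrightarrow> cmod (S $$ (i, j)) = 1"
    and mult_row: "i < N \<Longrightarrow> a < N \<Longrightarrow> \<exists>k<N. \<forall>j<N. S $$ (i, j) * S $$ (a, j) = S $$ (k, j)"
    and orthogonal: "i < N \<Longrightarrow> k < N \<Longrightarrow>
      (\<Sum>j<N. S $$ (i, j) * cnj (S $$ (k, j))) = (if i = k then of_nat N else 0)"

lemma norm_omega [simp]: "cmod (omega n) = 1"
  and cnj_omega_power: "cnj (omega n ^ a) = cis (2 * pi * real a / real n)"
proof -
  have *: "omega n = cis (- (2 * pi / real n))"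
    by (simp add: omega_def complex_eq_iff)
  show "cmod (omega n) = 1" by (simp add: *)
  show "cnj (omega n ^ a) = cis (2 * pi * real a / real n)"
    by (simp add: * cis_cnj DeMoivre mult_ac)
qed

text \<open>
  Orthogonality is the vanishing of the geometric sum of a root of unity $z \neq 1$, here with
  $z = \omega^i \bar\omega^k$.
\<close>

lemma character_table_fourier_mat:
  assumes n: "0 < n"
  shows "character_table n (fourier_mat n)"
proof
  let ?w = "omega n"
  have root: "?w ^ n = 1"
  proof -
    have "cnj (?w ^ n) = 1" unfolding cnj_omega_power using n by simp
    then show ?thesis by (metis complex_cnj_cnj complex_cnj_one)
  qed
  have unit: "?w ^ k * cnj (?w ^ k) = 1" for k
    by (simp add: complex_norm_square[symmetric] norm_power del: complex_cnj_power)
  fix i k assume i: "i < n" and k: "k < n"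
  show "\<exists>l<n. \<forall>j<n. fourier_mat n $$ (i, j) * fourier_mat n $$ (k, j) = fourier_mat n $$ (l, j)"
  proof (intro exI[of _ "(i + k) mod n"] conjI allI impI)
    fix j assume j: "j < n"
    have "?w ^ (i + k) = ?w ^ (n * ((i + k) div n) + (i + k) mod n)" by simp
    also have "\<dots> = ?w ^ ((i + k) mod n)" by (simp only: power_add power_mult root) simp
    finally have "(?w ^ ((i + k) mod n)) ^ j = (?w ^ (i + k)) ^ j" by simp
    then show "fourier_mat n $$ (i, j) * fourier_mat n $$ (k, j) = fourier_mat n $$ ((i + k) mod n, j)"
      using i j k n by (simp add: fourier_mat_def power_add power_mult power_mult_distrib)
  qed (use n in simp)
  define z where "z = ?w ^ i * cnj (?w ^ k)"
  have "(\<Sum>j<n. fourier_mat n $$ (i, j) * cnj (fourier_mat n $$ (k, j))) = (\<Sum>j<n. z ^ j)"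
    using i k by (simp add: fourier_mat_def z_def power_mult power_mult_distrib)
  also have "\<dots> = (if i = k then of_nat n else 0)"
  proof (cases "i = k")
    case True
    then show ?thesis using unit by (simp add: z_def del: complex_cnj_power)
  next
    case False
    have "z \<noteq> 1"
    proof
      assume "z = 1"
      then have "cnj (?w ^ i) = cnj (?w ^ i) * (?w ^ i * cnj (?w ^ k))" by (simp add: z_def)
      also have "\<dots> = cnj (?w ^ k)" using unit[of i] by (simp add: algebra_simps del: complex_cnj_power)
      finally have "cis (2 * pi * real i / real n) = cis (2 * pi * real k / real n)"
        unfolding cnj_omega_power .
      then show False
        using bij_betw_imp_inj_on[OF bij_betw_roots_unity[OF n]] False i k by (auto dest: inj_onD)
    qed
    moreover have "z ^ n = 1"
    proof -
      have "z ^ n = (?w ^ n) ^ i * cnj ((?w ^ n) ^ k)"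
        by (simp add: z_def power_mult_distrib mult.commute flip: power_mult)
      then show ?thesis by (simp add: root)
    qed
    ultimately show ?thesis using False by (simp add: geometric_sum)
  qed
  finally show "(\<Sum>j<n. fourier_mat n $$ (i, j) * cnj (fourier_mat n $$ (k, j)))
    = (if i = k then of_nat n else 0)" .
qed (use n in \<open>auto simp: fourier_mat_def norm_power\<close>)

lemma sum_lessThan_mult:
  fixes f :: "nat \<Rightarrow> nat \<Rightarrow> 'a :: comm_semiring_1"
  assumes "0 < n"
  shows "(\<Sum>j<m * n. f (j div n) (j mod n)) = (\<Sum>a<m. \<Sum>b<n. f a b)"
proof -
  have "(\<Sum>a<m. \<Sum>b<n. f a b) = (\<Sum>(a, b)\<in>{..<m} \<times> {..<n}. f a b)"
    by (rule sum.cartesian_product)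
  also have "\<dots> = (\<Sum>j<m * n. f (j div n) (j mod n))"
  proof (rule sum.reindex_bij_witness[of _ "\<lambda>j. (j div n, j mod n)" "\<lambda>(a, b). a * n + b"])
    fix ab assume "ab \<in> {..<m} \<times> {..<n}"
    then obtain a b where ab: "ab = (a, b)" "a < m" "b < n" by auto
    have "a * n + b < a * n + n" using ab by simp
    also have "\<dots> \<le> m * n" using ab mult_le_mono1[of "Suc a" m n] by simp
    finally show "(case ab of (a, b) \<Rightarrow> a * n + b) \<in> {..<m * n}" using ab by simp
  qed (use assms in \<open>auto simp: less_mult_imp_div_less split: prod.splits\<close>)
  finally show ?thesis by simp
qed

text \<open>
  The characters of a product of two groups are the products of characters of the factors; the sum
  in the orthogonality relation factors accordingly.
\<close>

lemma character_table_kronecker: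
  assumes "character_table m A" and "character_table n B"
  shows "character_table (m * n) (A \<otimes>\<^sub>K B)"
proof
  interpret A: character_table m A by fact
  interpret B: character_table n B by fact
  note pos = A.order_pos B.order_pos
  have quot: "i div n < m" "i mod n < n" if "i < m * n" for i
    using that pos by (auto simp: less_mult_imp_div_less)
  have entry: "(A \<otimes>\<^sub>K B) $$ (i, j) = A $$ (i div n, j div n) * B $$ (i mod n, j mod n)"
    if "i < m * n" "j < m * n" for i j
    using that A.carrier B.carrier by (simp add: kronecker_def)
  show "A \<otimes>\<^sub>K B \<in> carrier_mat (m * n) (m * n)"
    using A.carrier B.carrier by (simp add: kronecker_def)
  show "0 < m * n" using pos by simp
  fix i assume i: "i < m * n"
  show "(A \<otimes>\<^sub>K B) $$ (0, i) = 1" "(A \<otimes>\<^sub>K B) $$ (i, 0) = 1"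
    using i quot[OF i] pos by (simp_all add: entry A.first_row B.first_row A.first_col B.first_col)
  fix k assume k: "k < m * n"
  show "cmod ((A \<otimes>\<^sub>K B) $$ (i, k)) = 1"
    using i k quot by (simp add: entry norm_mult A.unimodular B.unimodular)
  obtain a where a: "a < m" "\<forall>j<m. A $$ (i div n, j) * A $$ (k div n, j) = A $$ (a, j)"
    using A.mult_row quot(1)[OF i] quot(1)[OF k] by blast
  obtain b where b: "b < n" "\<forall>j<n. B $$ (i mod n, j) * B $$ (k mod n, j) = B $$ (b, j)"
    using B.mult_row quot(2)[OF i] quot(2)[OF k] by blast
  have "a * n + b < a * n + n" using b by simp
  also have "\<dots> \<le> m * n" using a mult_le_mono1[of "Suc a" m n] by simp
  finally have l: "a * n + b < m * n" .
  show "\<exists>l<m * n. \<forall>j<m * n. (A \<otimes>\<^sub>K B) $$ (i, j) * (A \<otimes>\<^sub>K B) $$ (k, j) = (A \<otimes>\<^sub>K B) $$ (l, j)"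
  proof (intro exI[of _ "a * n + b"] conjI allI impI)
    fix j assume j: "j < m * n"
    have "(A \<otimes>\<^sub>K B) $$ (i, j) * (A \<otimes>\<^sub>K B) $$ (k, j)
        = (A $$ (i div n, j div n) * A $$ (k div n, j div n))
          * (B $$ (i mod n, j mod n) * B $$ (k mod n, j mod n))"
      using i j k by (simp add: entry)
    also have "\<dots> = A $$ (a, j div n) * B $$ (b, j mod n)"
      using a b quot[OF j] by simp
    also have "\<dots> = (A \<otimes>\<^sub>K B) $$ (a * n + b, j)"
      using entry[OF l j] b by simp
    finally show "(A \<otimes>\<^sub>K B) $$ (i, j) * (A \<otimes>\<^sub>K B) $$ (k, j) = (A \<otimes>\<^sub>K B) $$ (a * n + b, j)" .
  qed (rule l)
  have "(\<Sum>j<m * n. (A \<otimes>\<^sub>K B) $$ (i, j) * cnj ((A \<otimes>\<^sub>K B) $$ (k, j)))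
      = (\<Sum>j<m * n. (A $$ (i div n, j div n) * cnj (A $$ (k div n, j div n)))
          * (B $$ (i mod n, j mod n) * cnj (B $$ (k mod n, j mod n))))"
    using i k by (intro sum.cong) (auto simp: entry)
  also have "\<dots> = (\<Sum>a<m. A $$ (i div n, a) * cnj (A $$ (k div n, a)))
      * (\<Sum>b<n. B $$ (i mod n, b) * cnj (B $$ (k mod n, b)))"
    unfolding sum_product by (rule sum_lessThan_mult[OF pos(2)])
  also have "\<dots> = (if i div n = k div n then of_nat m else 0) * (if i mod n = k mod n then of_nat n else 0)"
    using quot[OF i] quot[OF k] by (simp add: A.orthogonal B.orthogonal)
  also have "\<dots> = (if i = k then of_nat (m * n) else 0)"
  proof -
    have "i div n = k div n \<and> i mod n = k mod n \<longleftrightarrow> i = k" by (metis div_mult_mod_eq)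
    then show ?thesis by auto
  qed
  finally show "(\<Sum>j<m * n. (A \<otimes>\<^sub>K B) $$ (i, j) * cnj ((A \<otimes>\<^sub>K B) $$ (k, j)))
      = (if i = k then of_nat (m * n) else 0)" .
qed

context character_table
begin

section \<open>The similarity defined by a character table\<close>

definition S_inv :: "complex mat" where
  "S_inv = mat N N (\<lambda>(i, j). cnj (S $$ (j, i)) / of_nat N)"

lemma S_inv_carrier: "S_inv \<in> carrier_mat N N"
  by (simp add: S_inv_def)

lemma mult_S_inv: "S * S_inv = 1\<^sub>m N"
  using carrier order_pos
  by (intro eq_matI)
    (auto simp: S_inv_def scalar_prod_def orthogonal lessThan_atLeast0[symmetric]
      simp flip: sum_divide_distrib)

lemma S_inv_mult: "S_inv * S = 1\<^sub>m N"
  by (rule mat_mult_left_right_inverse[OF carrier S_inv_carrier mult_S_inv])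

lemma invertible: "invertible_mat S"
  using mult_S_inv S_inv_mult carrier S_inv_carrier
  unfolding invertible_mat_def inverts_mat_def by auto

lemma mat_inv_eq: "mat_inv S = S_inv"
proof (cases "mat_inverse S")
  case None
  have "S \<in> Units (ring_mat TYPE(complex) N ())"
    using carrier S_inv_carrier mult_S_inv S_inv_mult
    unfolding Units_def ring_mat_def by auto
  moreover have "S \<notin> Units (ring_mat TYPE(complex) N ())"
    by (rule mat_inverse(1)[OF carrier None])
  ultimately show ?thesis by blast
next
  case (Some B)
  from mat_inverse(2)[OF carrier this] have B: "S * B = 1\<^sub>m N" "B * S = 1\<^sub>m N" "B \<in> carrier_mat N N"
    by auto
  have "B = (S_inv * S) * B" using B by (simp add: S_inv_mult)
  also have "\<dots> = S_inv" using B S_inv_carrier carrier by (simp add: assoc_mult_mat[of _ N N _ N _ N])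
  finally show ?thesis using Some by simp
qed

lemma column_sum:
  assumes "j < N"
  shows "(\<Sum>i<N. S $$ (i, j)) = (if j = 0 then of_nat N else 0)"
proof -
  have "(\<Sum>i<N. S $$ (i, j)) / of_nat N = (S_inv * S) $$ (0, j)"
    using assms carrier order_pos first_col
    by (simp add: S_inv_def scalar_prod_def lessThan_atLeast0[symmetric] sum_divide_distrib)
  also have "\<dots> = (if j = 0 then 1 else 0)"
    using assms order_pos by (simp add: S_inv_mult)
  finally show ?thesis using order_pos by (auto split: if_splits simp: field_simps)
qed

lemma M_mat_carrier:
  assumes "x \<in> carrier_vec N"
  shows "M_mat S x \<in> carrier_mat N N"
  using assms carrier S_inv_carrier unfolding M_mat_def mat_inv_eq by auto

lemma M_mat_entry:
  assumes x: "x \<in> carrier_vec N" and "a < N" "b < N"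
  shows "M_mat S x $$ (a, b) = (\<Sum>j<N. S $$ (a, j) * x $ j * cnj (S $$ (b, j))) / of_nat N"
proof -
  have "S * mat_diag N (\<lambda>i. x $ i) = mat N N (\<lambda>(i, j). S $$ (i, j) * x $ j)"
    by (rule mat_diag_mult_right[OF carrier])
  then show ?thesis
    using assms unfolding M_mat_def mat_inv_eq
    by (simp add: S_inv_def scalar_prod_def lessThan_atLeast0 sum_divide_distrib)
qed

section \<open>The spectracone is the row cone\<close>

text \<open>
  This is entry \<open>(a, b)\<close> of $M_x$ for \<open>x\<close> the row \<open>i\<close>. The first two factors multiply to a row of \<open>S\<close>,
  and orthogonality then makes the entry \<open>0\<close> or \<open>1\<close>.
\<close>

lemma M_mat_row_nonneg:
  assumes "i < N" "a < N" "b < N"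
  shows "(\<Sum>j<N. S $$ (a, j) * S $$ (i, j) * cnj (S $$ (b, j))) / of_nat N \<in> \<real>\<^sub>\<ge>\<^sub>0"
proof -
  obtain k where "k < N" "\<forall>j<N. S $$ (a, j) * S $$ (i, j) = S $$ (k, j)"
    using mult_row assms by blast
  then show ?thesis using assms orthogonal[of k b] order_pos by simp
qed

lemma row_cone_iff:
  "x \<in> row_cone S \<longleftrightarrow> x \<in> carrier_vec N \<and>
    (\<exists>c. (\<forall>i<N. 0 \<le> c i) \<and> (\<forall>j<N. x $ j = (\<Sum>i<N. complex_of_real (c i) * S $$ (i, j))))"
proof -
  have closed: "finsum_vec TYPE(complex) N (\<lambda>i. complex_of_real (c i) \<cdot>\<^sub>v row S i) {..<N}
      \<in> carrier_vec N" for c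
    using carrier by (intro finsum_vec_closed) auto
  have index: "finsum_vec TYPE(complex) N (\<lambda>i. complex_of_real (c i) \<cdot>\<^sub>v row S i) {..<N} $ j
      = (\<Sum>i<N. complex_of_real (c i) * S $$ (i, j))" if "j < N" for c j
    using carrier that by (subst index_finsum_vec) auto
  have "x = finsum_vec TYPE(complex) N (\<lambda>i. complex_of_real (c i) \<cdot>\<^sub>v row S i) {..<N}
      \<longleftrightarrow> x \<in> carrier_vec N \<and> (\<forall>j<N. x $ j = (\<Sum>i<N. complex_of_real (c i) * S $$ (i, j)))" for c
    using closed[of c] index[of _ c] by (auto intro!: eq_vecI)
  then show ?thesis
    using carrier unfolding row_cone_def by auto
qed

text \<open>
  Multiplying $M_x = S D_x S^{-1}$ on the right by \<open>S\<close> leaves $S D_x$, whose first row is \<open>x\<close> because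
  the first row of \<open>S\<close> consists of ones.
\<close>

lemma row_expansion:
  assumes x: "x \<in> carrier_vec N" and j: "j < N"
  shows "x $ j = (\<Sum>i<N. M_mat S x $$ (0, i) * S $$ (i, j))"
proof -
  let ?D = "mat_diag N (\<lambda>i. x $ i)"
  have "M_mat S x * S = (S * ?D) * (S_inv * S)"
    using x carrier S_inv_carrier unfolding M_mat_def mat_inv_eq
    by (subst assoc_mult_mat[of _ N N _ N _ N]) auto
  also have "\<dots> = S * ?D"
    using carrier by (simp add: S_inv_mult right_mult_one_mat[of _ N N])
  also have "\<dots> = mat N N (\<lambda>(i, j). S $$ (i, j) * x $ j)"
    by (rule mat_diag_mult_right[OF carrier])
  finally have "(M_mat S x * S) $$ (0, j) = x $ j"
    using j order_pos by (simp add: first_row)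
  then show ?thesis
    using M_mat_carrier[OF x] carrier order_pos j
    by (simp add: scalar_prod_def lessThan_atLeast0)
qed

lemma spectracone_eq_row_cone: "spectracone S = row_cone S"
proof (intro equalityI subsetI)
  fix x assume "x \<in> spectracone S"
  then have x: "x \<in> carrier_vec N" and "nonneg_mat (M_mat S x)"
    using carrier by (auto simp: spectracone_def)
  then have *: "M_mat S x $$ (0, i) \<in> \<real>\<^sub>\<ge>\<^sub>0" if "i < N" for i
    using that order_pos nonneg_mat_iff[OF M_mat_carrier[OF x]] by auto
  define c where "c i = Re (M_mat S x $$ (0, i))" for i
  have "0 \<le> c i" "M_mat S x $$ (0, i) = complex_of_real (c i)" if "i < N" for i
    using *[OF that] by (auto simp: c_def elim!: nonneg_Reals_cases)
  then show "x \<in> row_cone S"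
    using x row_expansion[OF x] unfolding row_cone_iff by (auto intro!: exI[of _ c])
next
  fix x assume "x \<in> row_cone S"
  then obtain c where x: "x \<in> carrier_vec N" and c: "\<forall>i<N. 0 \<le> c i"
    and xc: "\<forall>j<N. x $ j = (\<Sum>i<N. complex_of_real (c i) * S $$ (i, j))"
    unfolding row_cone_iff by auto
  have "M_mat S x $$ (a, b) \<in> \<real>\<^sub>\<ge>\<^sub>0" if ab: "a < N" "b < N" for a b
  proof -
    have "M_mat S x $$ (a, b) = (\<Sum>j<N. \<Sum>i<N. complex_of_real (c i) *
        (S $$ (a, j) * S $$ (i, j) * cnj (S $$ (b, j)))) / of_nat N"
      using xc by (simp add: M_mat_entry[OF x ab] sum_distrib_left sum_distrib_right mult_ac)
    also have "\<dots> = (\<Sum>i<N. complex_of_real (c i) *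
        ((\<Sum>j<N. S $$ (a, j) * S $$ (i, j) * cnj (S $$ (b, j))) / of_nat N))"
      by (subst sum.swap) (simp add: sum_distrib_left sum_divide_distrib)
    also have "\<dots> \<in> \<real>\<^sub>\<ge>\<^sub>0"
      using c ab M_mat_row_nonneg by (intro sum_nonneg_Reals nonneg_Reals_mult_I) auto
    finally show ?thesis .
  qed
  then show "x \<in> spectracone S"
    using x carrier nonneg_mat_iff[OF M_mat_carrier[OF x]] by (auto simp: spectracone_def)
qed

lemma row_in_spectracone:
  assumes "i < N"
  shows "row S i \<in> spectracone S"
proof -
  have "row S i $ j = (\<Sum>k<N. complex_of_real (if k = i then 1 else 0) * S $$ (k, j))" if "j < N" for j
  proof -
    have "(\<Sum>k<N. complex_of_real (if k = i then 1 else 0) * S $$ (k, j))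
        = (\<Sum>k<N. if k = i then S $$ (k, j) else 0)"
      by (intro sum.cong) auto
    then show ?thesis using assms carrier that by simp
  qed
  then show ?thesis
    using carrier unfolding spectracone_eq_row_cone row_cone_iff
    by (auto intro!: exI[of _ "\<lambda>k. if k = i then 1 else 0"])
qed

section \<open>Perron similarity and extremality\<close>

text \<open>
  Conjugating \<open>diag(N, 0, \<dots>, 0)\<close> gives the matrix of ones, since the first column of \<open>S\<close>
  consists of ones.
\<close>

lemma perron:
  assumes "2 \<le> N"
  shows "perron_similarity S"
proof -
  define x where "x = vec N (\<lambda>i. if i = 0 then of_nat N else 0 :: complex)"
  define D where "D = mat_diag N (\<lambda>i. x $ i)"
  have x: "x \<in> carrier_vec N" by (simp add: x_def)
  have "M_mat S x $$ (a, b) = 1" if ab: "a < N" "b < N" for a b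
  proof -
    have "(\<Sum>j<N. S $$ (a, j) * x $ j * cnj (S $$ (b, j))) = (\<Sum>j<N. if j = 0 then of_nat N else 0)"
      using ab by (intro sum.cong) (auto simp: x_def first_col)
    then show ?thesis using order_pos by (simp add: M_mat_entry[OF x ab])
  qed
  then have J: "M_mat S x = mat N N (\<lambda>_. 1)"
    using M_mat_carrier[OF x] by (intro eq_matI) auto
  have D_eq: "S * D * mat_inv S = mat N N (\<lambda>_. 1)"
    unfolding J[symmetric] M_mat_def D_def using x by simp
  have "nonneg_mat (mat N N (\<lambda>_. 1))"
    by (subst nonneg_mat_iff[of _ N N]) auto
  then have "irreducible_mat (S * D * mat_inv S) \<and> nonneg_mat (S * D * mat_inv S)"
    unfolding D_eq using irreducible_mat_of_ones[OF assms] by simp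
  moreover have "D \<in> carrier_mat (dim_row S) (dim_row S)" "diagonal_mat D"
    using carrier by (auto simp: D_def diagonal_mat_def mat_diag_def)
  ultimately show ?thesis unfolding perron_similarity_def using invertible by blast
qed

text \<open>The first column of \<open>S\<close>, which is \<open>e\<close>, is an eigenvector of $M_x$ for the eigenvalue $x_1$.\<close>

lemma M_mat_row_sum:
  assumes x: "x \<in> carrier_vec N" and a: "a < N"
  shows "(\<Sum>b<N. M_mat S x $$ (a, b)) = x $ 0"
proof -
  have col: "(\<Sum>b<N. cnj (S $$ (b, j))) = (if j = 0 then of_nat N else 0)" if "j < N" for j
    using column_sum[OF that] by (simp flip: cnj_sum)
  have "(\<Sum>b<N. M_mat S x $$ (a, b))
      = (\<Sum>b<N. \<Sum>j<N. S $$ (a, j) * x $ j * cnj (S $$ (b, j))) / of_nat N"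
    using a by (simp add: M_mat_entry[OF x] sum_divide_distrib)
  also have "(\<Sum>b<N. \<Sum>j<N. S $$ (a, j) * x $ j * cnj (S $$ (b, j)))
      = (\<Sum>j<N. S $$ (a, j) * x $ j * (\<Sum>b<N. cnj (S $$ (b, j))))"
    by (subst sum.swap) (simp add: sum_distrib_left)
  also have "\<dots> = (\<Sum>j<N. if j = 0 then S $$ (a, j) * x $ j * of_nat N else 0)"
    by (intro sum.cong) (auto simp: col)
  finally show ?thesis using a order_pos by (simp add: first_col)
qed

lemma proots_char_poly_M_mat:
  assumes x: "x \<in> carrier_vec N"
  shows "proots (char_poly (M_mat S x)) = mset (list_of_vec x)"
proof -
  let ?D = "mat_diag N (\<lambda>i. x $ i)"
  have "similar_mat (M_mat S x) ?D"
    using carrier S_inv_carrier M_mat_carrier[OF x] mult_S_inv S_inv_mult x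
    by (intro similar_matI[of _ _ S S_inv N]) (auto simp: M_mat_def mat_inv_eq)
  then have "char_poly (M_mat S x) = char_poly ?D" by (rule char_poly_similar)
  also have "\<dots> = (\<Prod>a\<leftarrow>diag_mat ?D. [:- a, 1:])"
    by (rule char_poly_upper_triangular[of _ N]) (auto simp: mat_diag_def)
  also have "diag_mat ?D = list_of_vec x"
    using x by (intro nth_equalityI) (auto simp: diag_mat_def mat_diag_def list_of_vec_index)
  finally have "char_poly (M_mat S x) = (\<Prod>a\<leftarrow>list_of_vec x. [:- a, 1:])" .
  moreover have "proots (\<Prod>a\<leftarrow>as. [:- a, 1:]) = mset as" for as :: "complex list"
  proof (induction as)
    case (Cons a as)
    have "(\<Prod>a\<leftarrow>as. [:- a, 1:]) \<noteq> 0" by (auto simp: prod_list_zero_iff)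
    then show ?case using Cons by (simp add: proots_mult del: mult_pCons_left)
  qed simp
  ultimately show ?thesis by simp
qed

lemma extremal:
  assumes N: "2 \<le> N"
  shows "extremal_similarity S"
proof -
  let ?x = "row S 1"
  have x: "?x \<in> carrier_vec N" "?x \<in> spectracone S" "?x $ 0 = 1"
    using N carrier row_in_spectracone[of 1] first_col by auto
  have row_sum: "(\<Sum>b<N. M_mat S ?x $$ (a, b)) = 1" if "a < N" for a
    using M_mat_row_sum[OF x(1) that] x(3) by simp
  have "stochastic_mat (M_mat S ?x)"
    using x row_sum M_mat_carrier[OF x(1)] by (auto simp: stochastic_mat_def spectracone_def)
  then have "?x \<in> SL1 N"
    using x M_mat_carrier[OF x(1)] proots_char_poly_M_mat[OF x(1)] unfolding SL1_def by auto
  moreover have "cmod (?x $ 1) = 1" using N carrier unimodular[of 1 1] by simp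
  ultimately have "extremal_point N ?x"
    using N by (intro extremal_point_if_unimodular_entry[of _ _ 1]) auto
  moreover have "?x \<noteq> ones_vec N"
  proof
    \<comment> \<open>Otherwise row \<open>1\<close> would equal row \<open>0\<close>, to which it is orthogonal.\<close>
    assume eq: "?x = ones_vec N"
    have "S $$ (1, j) = 1" if "j < N" for j
      using arg_cong[OF eq, of "\<lambda>v. v $ j"] N carrier that by (simp add: ones_vec_def)
    then show False using orthogonal[of 1 0] N first_row by simp
  qed
  moreover have "M_mat S ?x *\<^sub>v ones_vec N = ones_vec N"
    using M_mat_carrier[OF x(1)] row_sum
    by (intro eq_vecI) (auto simp: ones_vec_def scalar_prod_def lessThan_atLeast0)
  moreover have "col S 0 = ones_vec N"
    using carrier order_pos first_col by (intro eq_vecI) (auto simp: ones_vec_def)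
  ultimately show ?thesis
    using perron[OF N] x carrier unfolding extremal_similarity_def spectratope_def by auto
qed

section \<open>Dimension of the spectracone\<close>

text \<open>Pairing a combination of the rows with row \<open>k\<close> isolates the coefficient \<open>c k\<close>.\<close>

lemma row_combination_unique:
  assumes zero: "\<forall>j<N. (\<Sum>i<N. c i * S $$ (i, j)) = 0" and k: "k < N"
  shows "c k = 0"
proof -
  have "0 = (\<Sum>j<N. (\<Sum>i<N. c i * S $$ (i, j)) * cnj (S $$ (k, j)))"
    using zero by simp
  also have "\<dots> = (\<Sum>i<N. c i * (\<Sum>j<N. S $$ (i, j) * cnj (S $$ (k, j))))"
    unfolding sum_distrib_left sum_distrib_right by (subst sum.swap) (simp add: mult_ac)
  also have "\<dots> = (\<Sum>i<N. if i = k then c i * of_nat N else 0)"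
    using k by (intro sum.cong) (auto simp: orthogonal)
  finally show ?thesis using k order_pos by simp
qed

text \<open>
  Every real number is a difference of two nonnegative ones, so the differences of points of the row
  cone are all real combinations of the rows.
\<close>

lemma spectracone_differences:
  "{u - v |u v. u \<in> spectracone S \<and> v \<in> spectracone S}
    = {x \<in> carrier_vec N. \<exists>c. \<forall>j<N. x $ j = (\<Sum>i<N. complex_of_real (c i) * S $$ (i, j))}"
    (is "?L = ?R")
proof (intro equalityI subsetI)
  fix x assume "x \<in> ?L"
  then obtain u v where uv: "x = u - v" "u \<in> row_cone S" "v \<in> row_cone S"
    by (auto simp: spectracone_eq_row_cone)
  then obtain c d where "u \<in> carrier_vec N" "v \<in> carrier_vec N"
    "\<forall>j<N. u $ j = (\<Sum>i<N. complex_of_real (c i) * S $$ (i, j))"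
    "\<forall>j<N. v $ j = (\<Sum>i<N. complex_of_real (d i) * S $$ (i, j))"
    unfolding row_cone_iff by auto
  then show "x \<in> ?R"
    using uv(1) by (auto intro!: exI[of _ "\<lambda>i. c i - d i"] simp: sum_subtractf algebra_simps)
next
  fix x assume "x \<in> ?R"
  then obtain c where x: "x \<in> carrier_vec N"
    and c: "\<forall>j<N. x $ j = (\<Sum>i<N. complex_of_real (c i) * S $$ (i, j))" by auto
  define comb where "comb d = vec N (\<lambda>j. \<Sum>i<N. complex_of_real (d i) * S $$ (i, j))"
    for d :: "nat \<Rightarrow> real"
  have cone: "comb d \<in> spectracone S" if "\<And>i. 0 \<le> d i" for d
    unfolding spectracone_eq_row_cone row_cone_iff using that
    by (auto simp: comb_def intro!: exI[of _ d])
  have "x = comb (\<lambda>i. max (c i) 0) - comb (\<lambda>i. max (- c i) 0)"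
  proof (rule eq_vecI)
    fix j assume "j < dim_vec (comb (\<lambda>i. max (c i) 0) - comb (\<lambda>i. max (- c i) 0))"
    then have j: "j < N" by (simp add: comb_def)
    have "complex_of_real (c i) = complex_of_real (max (c i) 0) - complex_of_real (max (- c i) 0)" for i
      by (simp add: max_def)
    then show "x $ j = (comb (\<lambda>i. max (c i) 0) - comb (\<lambda>i. max (- c i) 0)) $ j"
      using c j by (simp add: comb_def left_diff_distrib flip: sum_subtractf)
  qed (use x in \<open>auto simp: comb_def\<close>)
  then show "x \<in> ?L" using cone by fastforce
qed

lemma cone_dim_spectracone: "cone_dim N (spectracone S) = N"
  unfolding cone_dim_def spectracone_differences
proof (rule dim_real_vs[where b = "row S"])
  let ?W = "{x \<in> carrier_vec N. \<exists>c. \<forall>j<N. x $ j = (\<Sum>i<N. complex_of_real (c i) * S $$ (i, j))}"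
  show "?W \<subseteq> carrier_vec N" by auto
  show "0\<^sub>v N \<in> ?W" by (auto intro!: exI[of _ "\<lambda>_. 0"])
  show "u + v \<in> ?W" if uv: "u \<in> ?W" "v \<in> ?W" for u v
  proof -
    from uv obtain c d where "\<forall>j<N. u $ j = (\<Sum>i<N. complex_of_real (c i) * S $$ (i, j))"
      "\<forall>j<N. v $ j = (\<Sum>i<N. complex_of_real (d i) * S $$ (i, j))" by auto
    then show ?thesis
      using uv by (auto intro!: exI[of _ "\<lambda>i. c i + d i"] simp: sum.distrib algebra_simps)
  qed
  show "complex_of_real r \<cdot>\<^sub>v u \<in> ?W" if u: "u \<in> ?W" for r u
  proof -
    from u obtain c where "\<forall>j<N. u $ j = (\<Sum>i<N. complex_of_real (c i) * S $$ (i, j))" by auto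
    then show ?thesis
      using u by (auto intro!: exI[of _ "\<lambda>i. r * c i"] simp: sum_distrib_left mult_ac)
  qed
  show "row S i \<in> ?W" if "i < N" for i
    using row_in_spectracone[OF that] unfolding spectracone_eq_row_cone row_cone_iff by auto
  show "inj_on (row S) {..<N}"
  proof (rule inj_onI)
    fix i k assume ik: "i \<in> {..<N}" "k \<in> {..<N}" "row S i = row S k"
    then have "S $$ (i, j) = S $$ (k, j)" if "j < N" for j
      using that carrier by (metis carrier_matD index_row(1) lessThan_iff)
    then have "(\<Sum>j<N. S $$ (i, j) * cnj (S $$ (k, j))) = (\<Sum>j<N. S $$ (k, j) * cnj (S $$ (k, j)))"
      by simp
    then show "i = k" using ik order_pos by (auto simp: orthogonal split: if_splits)
  qed
  have row_index: "(\<Sum>i<N. complex_of_real (c i) * row S i $ j)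
      = (\<Sum>i<N. complex_of_real (c i) * S $$ (i, j))" if "j < N" for c j
    using that carrier by (intro sum.cong) auto
  show "\<exists>c. \<forall>j<N. w $ j = (\<Sum>i<N. complex_of_real (c i) * row S i $ j)" if "w \<in> ?W" for w
    using that row_index by auto
  show "\<forall>i<N. c i = 0" if "\<forall>j<N. (\<Sum>i<N. complex_of_real (c i) * row S i $ j) = 0" for c
    using row_combination_unique[of "\<lambda>i. complex_of_real (c i)"] that row_index by auto
qed

end

section \<open>The Kronecker product of two Fourier matrices\<close>

theorem theorem7p8:
  fixes m n :: nat
  assumes "0 < m" and "0 < n" and "2 \<le> m * n"
  shows "ideal_similarity (fourier_mat m \<otimes>\<^sub>K fourier_mat n) \<and>
    extremal_similarity (fourier_mat m \<otimes>\<^sub>K fourier_mat n) \<and>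
    cone_dim (m * n) (spectracone (fourier_mat m \<otimes>\<^sub>K fourier_mat n)) = m * n"
proof -
  interpret character_table "m * n" "fourier_mat m \<otimes>\<^sub>K fourier_mat n"
    using assms by (intro character_table_kronecker character_table_fourier_mat)
  show ?thesis
    using perron extremal spectracone_eq_row_cone cone_dim_spectracone assms(3)
    unfolding ideal_similarity_def by auto
qed

end
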